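(* Let $N/2<K<N$ be integers. For $\eta\in\mathcal E_{N,K}$ and $k,l\in\mathbb T_K$ set $$\sigma^{(k,\eta)}_l=2-x_{k+l}(\eta)+x_{k+l-1}(\eta),$$ where the rank indices $k+l$, $k+l-1$ are taken in $\mathbb T_K$ and the difference of positions $x_{k+l}(\eta)-x_{k+l-1}(\eta)$ is taken modulo $N$, with representative in $\{1,\dots,N\}$. Then $\sigma^{(k,\eta)}\in\Gamma_{K,2K-N}$, and the map $$\Phi:\ \mathbb T_K\times\mathcal E_{N,K}\to\mathbb T_N\times\Gamma_{K,2K-N},\qquad(k,\eta)\mapsto\big(x_k(\eta),\sigma^{(k,\eta)}\big)$$ is bijective.
   Context: For an integer $M$, $\mathbb T_M=\mathbb Z/M\mathbb Z$ with elements written $1,\dots,M$. For integers $0\le Q\le M$, $\Gamma_{M,Q}=\{\eta\in\{0,1\}^{\mathbb T_M}:\sum_{x}\eta_x=Q\}$. Further $\mathcal E_{N,K}=\{\eta\in\Gamma_{N,K}:\eta_x+\eta_{x+1}\ge1\ \forall x\in\mathbb T_N\}$. For $\eta\in\Gamma_{N,K}$ and $k\in\mathbb T_K=\{1,\dots,K\}$, $x_k(\eta)=\inf\{x\in\{1,\dots,N\}:\sum_{y=1}^x\eta_y=k\}$ is the position of the $k$-th particle of $\eta$. *)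

theory Defs
  imports Complex_Main "HOL-Library.FuncSet"
begin

text \<open>
  The discrete torus $\mathbb{Z}/M\mathbb{Z}$, carried by its representatives $1, \dots, M$.
  The function \<open>rep M\<close> sends an integer to the representative of its class modulo \<open>M\<close>;
  arithmetic in the torus is integer arithmetic followed by \<open>rep M\<close>.
\<close>

definition torus :: "int \<Rightarrow> int set" where
  "torus M = {1..M}"

definition rep :: "int \<Rightarrow> int \<Rightarrow> int" where
  "rep M z = (z - 1) mod M + 1"

text \<open>
  Configurations are extensional functions (\<open>undefined\<close> off the torus), so that equality of
  configurations is equality on the torus.
\<close>

definition Gamma :: "int \<Rightarrow> int \<Rightarrow> (int \<Rightarrow> int) set" where
  "Gamma M Q = {\<eta> \<in> torus M \<rightarrow>\<^sub>E {0, 1}. (\<Sum>x\<in>torus M. \<eta> x) = Q}"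

definition Erg :: "int \<Rightarrow> int \<Rightarrow> (int \<Rightarrow> int) set" where
  "Erg N K = {\<eta> \<in> Gamma N K. \<forall>x\<in>torus N. \<eta> x + \<eta> (rep N (x + 1)) \<ge> 1}"

definition pos :: "int \<Rightarrow> (int \<Rightarrow> int) \<Rightarrow> int \<Rightarrow> int" where
  "pos N \<eta> k = Inf {x \<in> {1..N}. (\<Sum>y\<in>{1..x}. \<eta> y) = k}"

text \<open>
  Only the difference of positions is reduced modulo \<open>N\<close>; the subtraction from 2 is in the
  integers.
\<close>

definition sigma :: "int \<Rightarrow> int \<Rightarrow> int \<Rightarrow> (int \<Rightarrow> int) \<Rightarrow> (int \<Rightarrow> int)" where
  "sigma N K k \<eta> = (\<lambda>l\<in>torus K.
     2 - rep N (pos N \<eta> (rep K (k + l)) - pos N \<eta> (rep K (k + l - 1))))"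

definition Phi :: "int \<Rightarrow> int \<Rightarrow> int \<times> (int \<Rightarrow> int) \<Rightarrow> int \<times> (int \<Rightarrow> int)" where
  "Phi N K = (\<lambda>(k, \<eta>). (pos N \<eta> k, sigma N K k \<eta>))"

end

(* In an ergodic configuration two consecutive particles are at distance 1 or 2, and the distance
   is 1 exactly when the site after the first one is occupied.  Hence sigma_l = eta (x_{k+l-1} + 1)
   and x_{k+l} = x_{k+l-1} + 2 - sigma_l: the positions, and so eta, are recovered from x_k and
   sigma by following these steps around the torus.  The mass of sigma is the number of adjacent
   pairs of particles.  Summing (1 - eta_y)(1 - eta_{y+1}) over the torus shows that this number
   is 2K - N exactly for the ergodic configurations, which also proves that the configuration
   rebuilt from an arbitrary (x, sigma) is ergodic. *)
theory Submission
  imports Defs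
begin

section \<open>Representatives on the discrete torus\<close>

lemma rep_in_torus: "M > 0 \<Longrightarrow> rep M z \<in> torus M"
  by (simp add: rep_def torus_def add.commute int_one_le_iff_zero_less)
    (smt (verit) pos_mod_bound pos_mod_sign)

lemma rep_id: "z \<in> torus M \<Longrightarrow> rep M z = z"
  by (simp add: rep_def torus_def)

lemma rep_eq_iff: "rep M a = rep M b \<longleftrightarrow> a mod M = b mod M"
  by (auto simp: rep_def mod_eq_dvd_iff)

lemma rep_mod: "rep M a mod M = a mod M"
  by (simp add: rep_def mod_simps)

lemma rep_add_left: "rep M (rep M a + b) = rep M (a + b)"
  unfolding rep_eq_iff by (metis mod_add_left_eq rep_mod)

lemma rep_diff: "rep M (rep M a - b) = rep M (a - b)"
  using rep_add_left[of M a "- b"] by simp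

text \<open>A window of \<open>M\<close> consecutive integers meets each class at most once. This
  turns equality of torus sites into equality of their integer lifts.\<close>

lemma inj_on_rep: "inj_on (rep M) {x..<x + M}"
proof (rule inj_onI)
  fix a b assume a: "a \<in> {x..<x + M}" and b: "b \<in> {x..<x + M}" and "rep M a = rep M b"
  then have "(a - x) mod M = (b - x) mod M"
    unfolding rep_eq_iff by (metis mod_diff_left_eq)
  with a b show "a = b" by simp
qed

lemma bij_betw_rep_shift:
  assumes "M > 0"
  shows "bij_betw (\<lambda>z. rep M (z + c)) (torus M) (torus M)"
  using assms
  by (intro bij_betw_byWitness[where f' = "\<lambda>z. rep M (z - c)"])
    (auto simp: rep_in_torus rep_diff rep_add_left rep_id)

lemma finite_torus [simp]: "finite (torus M)"
  by (simp add: torus_def)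

section \<open>Occupied sites, ranks and positions\<close>

definition occ :: "int \<Rightarrow> (int \<Rightarrow> int) \<Rightarrow> int set" where
  "occ N \<eta> = {x \<in> torus N. \<eta> x = 1}"

text \<open>On an occupied site this is the rank of the particle, hence the inverse of
  \<open>pos\<close>; reasoning with it avoids the infimum.\<close>

definition count :: "(int \<Rightarrow> int) \<Rightarrow> int \<Rightarrow> int" where
  "count \<eta> x = (\<Sum>y\<in>{1..x}. \<eta> y)"

lemma Gamma_01: "\<eta> \<in> Gamma N K \<Longrightarrow> x \<in> torus N \<Longrightarrow> \<eta> x = 0 \<or> \<eta> x = 1"
  by (auto simp: Gamma_def)

lemma Gamma_sum: "\<eta> \<in> Gamma N K \<Longrightarrow> (\<Sum>x\<in>torus N. \<eta> x) = K"
  by (simp add: Gamma_def)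

lemma Gamma_eqI:
  assumes "\<eta> \<in> Gamma N K" "\<zeta> \<in> Gamma N L" "occ N \<eta> = occ N \<zeta>"
  shows "\<eta> = \<zeta>"
proof (rule PiE_ext)
  show "\<eta> \<in> torus N \<rightarrow>\<^sub>E {0, 1}" "\<zeta> \<in> torus N \<rightarrow>\<^sub>E {0, 1}"
    using assms by (auto simp: Gamma_def)
  show "\<eta> x = \<zeta> x" if "x \<in> torus N" for x
    using assms(3) that Gamma_01[OF assms(1) that] Gamma_01[OF assms(2) that]
    by (force simp: occ_def set_eq_iff)
qed

lemma finite_occ [simp]: "finite (occ N \<eta>)"
  by (simp add: occ_def)

lemma sum_occ:
  assumes "\<And>x. x \<in> torus N \<Longrightarrow> \<eta> x = 0 \<or> \<eta> x = 1"
  shows "(\<Sum>x\<in>torus N. \<eta> x * f x) = (\<Sum>x\<in>occ N \<eta>. f x)"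
proof -
  have "(\<Sum>x\<in>torus N. \<eta> x * f x) = (\<Sum>x\<in>occ N \<eta>. \<eta> x * f x)"
    using assms by (intro sum.mono_neutral_right) (auto simp: occ_def)
  then show ?thesis by (simp add: occ_def)
qed

lemma card_occ: "\<eta> \<in> Gamma N K \<Longrightarrow> int (card (occ N \<eta>)) = K"
  using sum_occ[of N \<eta> "\<lambda>_. 1"] Gamma_01[of \<eta> N K] Gamma_sum[of \<eta> N K] by simp

lemma count_step: "x \<ge> 0 \<Longrightarrow> count \<eta> (x + 1) = count \<eta> x + \<eta> (x + 1)"
proof -
  assume "x \<ge> 0"
  then have "{1..x + 1} = insert (x + 1) {1..x}" by auto
  then show ?thesis by (simp add: count_def)
qed

lemma count_N: "\<eta> \<in> Gamma N K \<Longrightarrow> count \<eta> N = K"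
  using Gamma_sum[of \<eta> N K] by (simp add: count_def torus_def)

lemma count_mono:
  assumes "\<eta> \<in> Gamma N K" "a \<le> b" "b \<le> N"
  shows "count \<eta> a \<le> count \<eta> b"
  unfolding count_def
proof (rule sum_mono2)
  fix y assume "y \<in> {1..b} - {1..a}"
  then have "y \<in> torus N" using assms by (auto simp: torus_def)
  then show "0 \<le> \<eta> y" using Gamma_01[OF assms(1)] by force
qed (use assms in auto)

text \<open>The count jumps at \<open>b\<close> itself, so \<open>a\<close> may be an empty site or
  even 0; \<open>pos_count\<close> and \<open>count_in_torus\<close> rely on this.\<close>

lemma count_less:
  assumes "\<eta> \<in> Gamma N K" "a < b" "b \<in> occ N \<eta>"
  shows "count \<eta> a < count \<eta> b"
proof -
  have b: "1 \<le> b" "b \<le> N" "\<eta> b = 1" using assms by (auto simp: occ_def torus_def)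
  have "count \<eta> a \<le> count \<eta> (b - 1)" using b assms by (intro count_mono) auto
  also have "\<dots> < count \<eta> b" using count_step[of "b - 1" \<eta>] b by simp
  finally show ?thesis .
qed

lemma count_in_torus:
  assumes "\<eta> \<in> Gamma N K" "x \<in> occ N \<eta>"
  shows "count \<eta> x \<in> torus K"
proof -
  have x: "1 \<le> x" "x \<le> N" using assms by (auto simp: occ_def torus_def)
  have "count \<eta> 0 < count \<eta> x" using assms x by (intro count_less) auto
  moreover have "count \<eta> x \<le> count \<eta> N" using assms x by (intro count_mono) auto
  ultimately show ?thesis
    using count_N[OF assms(1)] by (simp add: torus_def count_def)
qed

lemma bij_betw_count:
  assumes "\<eta> \<in> Gamma N K"
  shows "bij_betw (count \<eta>) (occ N \<eta>) (torus K)"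
proof -
  have inj: "inj_on (count \<eta>) (occ N \<eta>)"
    by (rule inj_onI) (metis assms count_less less_irrefl linorder_neqE)
  \<comment> \<open>Surjectivity by cardinality: the image lies in \<open>torus K\<close> and both
    have \<open>K\<close> elements.\<close>
  have "count \<eta> ` occ N \<eta> = torus K"
  proof (rule card_subset_eq)
    show "count \<eta> ` occ N \<eta> \<subseteq> torus K" using count_in_torus[OF assms] by auto
    show "card (count \<eta> ` occ N \<eta>) = card (torus K)"
      using card_image[OF inj] card_occ[OF assms] by (auto simp: torus_def)
  qed simp
  with inj show ?thesis by (simp add: bij_betw_def)
qed

text \<open>Every site before the particle at \<open>x\<close> has a strictly smaller count, so the
  infimum is a minimum, attained at \<open>x\<close>.\<close>

lemma pos_count:
  assumes "\<eta> \<in> Gamma N K" "x \<in> occ N \<eta>"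
  shows "pos N \<eta> (count \<eta> x) = x"
  unfolding pos_def
proof (rule cInf_eq_minimum)
  show "x \<in> {z \<in> {1..N}. (\<Sum>y\<in>{1..z}. \<eta> y) = count \<eta> x}"
    using assms by (auto simp: occ_def torus_def count_def)
  show "x \<le> z" if "z \<in> {z \<in> {1..N}. (\<Sum>y\<in>{1..z}. \<eta> y) = count \<eta> x}" for z
    using that count_less[OF assms(1) _ assms(2), of z] by (force simp: count_def)
qed

lemma pos_occ:
  assumes "\<eta> \<in> Gamma N K" "k \<in> torus K"
  shows "pos N \<eta> k \<in> occ N \<eta>" "count \<eta> (pos N \<eta> k) = k"
proof -
  obtain x where "x \<in> occ N \<eta>" "k = count \<eta> x"
    using bij_betw_count[OF assms(1)] assms(2) by (auto simp: bij_betw_def)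
  then show "pos N \<eta> k \<in> occ N \<eta>" "count \<eta> (pos N \<eta> k) = k"
    using pos_count[OF assms(1)] by auto
qed

lemma bij_betw_pos: "\<eta> \<in> Gamma N K \<Longrightarrow> bij_betw (pos N \<eta>) (torus K) (occ N \<eta>)"
  by (rule bij_betw_byWitness[where f' = "count \<eta>"])
    (auto simp: pos_occ pos_count count_in_torus)

text \<open>Reading the particles cyclically from any rank \<open>k\<close> visits each exactly
  once; this allows sums and images over \<open>l\<close> to be rewritten over
  \<open>occ N \<eta>\<close>.\<close>

lemma bij_betw_pos_shift:
  assumes "\<eta> \<in> Gamma N K" "K > 0"
  shows "bij_betw (\<lambda>l. pos N \<eta> (rep K (k + l - 1))) (torus K) (occ N \<eta>)"
proof -
  have "bij_betw (pos N \<eta> \<circ> (\<lambda>l. rep K (l + (k - 1)))) (torus K) (occ N \<eta>)"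
    using bij_betw_rep_shift[OF assms(2)] bij_betw_pos[OF assms(1)] by (rule bij_betw_trans)
  then show ?thesis by (simp add: o_def algebra_simps)
qed

section \<open>Ergodicity as a count of adjacent pairs\<close>

lemma Erg_iff:
  assumes "\<eta> \<in> Gamma N K" "N > 0"
  shows "\<eta> \<in> Erg N K \<longleftrightarrow> (\<Sum>x\<in>occ N \<eta>. \<eta> (rep N (x + 1))) = 2 * K - N"
proof -
  let ?s = "\<lambda>x. rep N (x + 1)"
  have s: "?s x \<in> torus N" for x using assms by (simp add: rep_in_torus)
  note 01 = Gamma_01[OF assms(1)]
  have nonneg: "(1 - \<eta> x) * (1 - \<eta> (?s x)) \<ge> 0" if "x \<in> torus N" for x
    using 01[OF that] 01[OF s, of x] by auto
  have shift: "(\<Sum>x\<in>torus N. \<eta> (?s x)) = K"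
    using sum.reindex_bij_betw[OF bij_betw_rep_shift[OF assms(2), of 1], of \<eta>]
      Gamma_sum[OF assms(1)] by simp
  have card: "(\<Sum>x\<in>torus N. 1) = N" using assms by (simp add: torus_def)
  have "\<eta> \<in> Erg N K \<longleftrightarrow> (\<forall>x\<in>torus N. (1 - \<eta> x) * (1 - \<eta> (?s x)) = 0)"
  proof -
    have "\<eta> x + \<eta> (?s x) \<ge> 1 \<longleftrightarrow> (1 - \<eta> x) * (1 - \<eta> (?s x)) = 0" if "x \<in> torus N" for x
      using 01[OF that] 01[OF s, of x] by auto
    then show ?thesis using assms(1) by (auto simp: Erg_def)
  qed
  \<comment> \<open>The terms are nonnegative, so the condition at every site becomes a single
    equation.\<close>
  also have "\<dots> \<longleftrightarrow> (\<Sum>x\<in>torus N. (1 - \<eta> x) * (1 - \<eta> (?s x))) = 0"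
    using nonneg by (subst sum_nonneg_eq_0_iff) auto
  also have "(\<Sum>x\<in>torus N. (1 - \<eta> x) * (1 - \<eta> (?s x))) =
      (\<Sum>x\<in>torus N. 1 - \<eta> x - \<eta> (?s x) + \<eta> x * \<eta> (?s x))"
    by (rule sum.cong) (auto simp: algebra_simps)
  \<comment> \<open>One \<open>K\<close> is the mass of \<open>\<eta>\<close>, the other that of its
    translate by one site.\<close>
  also have "\<dots> = N - K - K + (\<Sum>x\<in>occ N \<eta>. \<eta> (?s x))"
    using card shift Gamma_sum[OF assms(1)] sum_occ[of N \<eta> "\<lambda>x. \<eta> (?s x)"] 01
    by (simp only: sum.distrib sum_subtractf)
  finally show ?thesis by auto
qed

section \<open>From one particle to the next\<close>

lemma count_rep_step:
  assumes "\<eta> \<in> Gamma N K" "N > 0" "x \<in> torus N"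
  shows "count \<eta> (rep N (x + 1)) mod K = (count \<eta> x + \<eta> (rep N (x + 1))) mod K"
\<comment> \<open>At the seam the count falls from \<open>K\<close> to \<open>\<eta> 1\<close>,
  which is why the claim holds only modulo \<open>K\<close>.\<close>
proof (cases "x = N")
  case True
  then have "rep N (x + 1) = 1" by (simp add: rep_def)
  moreover have "count \<eta> 1 = \<eta> 1" by (simp add: count_def)
  ultimately show ?thesis using True count_N[OF assms(1)] by simp
next
  case False
  then have "x + 1 \<in> torus N" using assms by (auto simp: torus_def)
  then show ?thesis using assms by (simp add: rep_id count_step torus_def)
qed

text \<open>If the site after a particle is empty, ergodicity forces the one after that to be occupied.\<close>

lemma pos_step:
  assumes "\<eta> \<in> Erg N K" "N > 0" "K > 0"
  defines "p \<equiv> \<lambda>j. pos N \<eta> (rep K j)"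
  shows "p (j + 1) = rep N (p j + 2 - \<eta> (rep N (p j + 1)))"
proof -
  have G: "\<eta> \<in> Gamma N K" using assms by (simp add: Erg_def)
  define x where "x = p j"
  define u where "u = rep N (x + 1)"
  \<comment> \<open>The candidate for the next particle: \<open>u\<close> if it is occupied,
    otherwise the site after \<open>u\<close>.\<close>
  define y where "y = rep N (x + 2 - \<eta> u)"
  have j: "rep K j \<in> torus K" using assms by (simp add: rep_in_torus)
  have x: "x \<in> torus N" "count \<eta> x = rep K j"
    using pos_occ[OF G j] by (auto simp: x_def p_def occ_def)
  have u: "u \<in> torus N" "count \<eta> u mod K = (count \<eta> x + \<eta> u) mod K"
    using rep_in_torus[OF assms(2)] count_rep_step[OF G assms(2) x(1)] by (auto simp: u_def)
  have y: "y \<in> torus N" using assms by (simp add: y_def rep_in_torus)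
  have "\<eta> y = 1 \<and> count \<eta> y mod K = (count \<eta> x + 1) mod K"
  proof (cases "\<eta> u = 1")
    case True
    then have "y = u" by (simp add: y_def u_def add.commute)
    with True u show ?thesis by simp
  next
    case False
    then have u0: "\<eta> u = 0" using Gamma_01[OF G u(1)] by auto
    then have yu: "y = rep N (u + 1)" using rep_add_left[of N "x + 1" 1] by (simp add: y_def u_def add.commute)
    have "\<eta> u + \<eta> y \<ge> 1" using assms(1) u(1) yu by (auto simp: Erg_def)
    then have y1: "\<eta> y = 1" using Gamma_01[OF G y] u0 by auto
    have "count \<eta> y mod K = (count \<eta> u + 1) mod K"
      using count_rep_step[OF G assms(2) u(1)] yu y1 by simp
    also have "\<dots> = (count \<eta> x + 1) mod K" using u(2) u0 by (metis add_0_right mod_add_left_eq)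
    finally show ?thesis using y1 by simp
  qed
  then have occ: "y \<in> occ N \<eta>" and "count \<eta> y mod K = (rep K j + 1) mod K"
    using y x by (auto simp: occ_def)
  then have "rep K (count \<eta> y) = rep K (j + 1)"
    by (metis rep_eq_iff rep_add_left)
  then have "count \<eta> y = rep K (j + 1)"
    using count_in_torus[OF G occ] by (simp add: rep_id)
  then show ?thesis
    using pos_count[OF G occ] by (simp add: p_def x_def y_def u_def)
qed

lemma sigma_eq:
  assumes "\<eta> \<in> Erg N K" "N \<ge> 2" "K > 0" "l \<in> torus K"
  shows "sigma N K k \<eta> l = \<eta> (rep N (pos N \<eta> (rep K (k + l - 1)) + 1))"
proof -
  define x where "x = pos N \<eta> (rep K (k + l - 1))"
  define e where "e = \<eta> (rep N (x + 1))"
  have "e = 0 \<or> e = 1"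
    unfolding e_def using assms by (intro Gamma_01[of \<eta> N K]) (auto simp: Erg_def rep_in_torus)
  \<comment> \<open>The distance is 1 or 2, and \<open>N \<ge> 2\<close> makes it its own
    representative, so reduction modulo \<open>N\<close> leaves it unchanged.\<close>
  then have "2 - e \<in> torus N" using assms by (auto simp: torus_def)
  moreover have "pos N \<eta> (rep K (k + l)) = rep N (x + 2 - e)"
    using pos_step[OF assms(1) _ assms(3), of "k + l - 1"] assms(2)
    by (simp add: x_def e_def)
  ultimately have "rep N (pos N \<eta> (rep K (k + l)) - x) = 2 - e"
    by (simp add: rep_diff rep_id)
  then show ?thesis using assms(4) by (simp add: sigma_def x_def e_def)
qed

lemma pos_step_sigma:
  assumes "\<eta> \<in> Erg N K" "N \<ge> 2" "K > 0" "l \<in> torus K"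
  shows "pos N \<eta> (rep K (k + l)) = rep N (pos N \<eta> (rep K (k + l - 1)) + 2 - sigma N K k \<eta> l)"
  using pos_step[OF assms(1) _ assms(3), of "k + l - 1"] sigma_eq[OF assms, of k] assms(2) by simp

text \<open>By \<open>sigma_eq\<close> and cyclic reindexing, the mass of \<open>sigma\<close> is
  the number of adjacent pairs, whatever \<open>k\<close> is; \<open>Erg_iff\<close> evaluates
  it.\<close>

lemma sigma_in_Gamma:
  assumes "\<eta> \<in> Erg N K" "N \<ge> 2" "K > 0"
  shows "sigma N K k \<eta> \<in> Gamma K (2 * K - N)"
proof -
  have G: "\<eta> \<in> Gamma N K" using assms by (simp add: Erg_def)
  have "sigma N K k \<eta> l \<in> {0, 1}" if "l \<in> torus K" for l
    using Gamma_01[OF G] rep_in_torus[of N] assms sigma_eq[OF assms that] by simp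
  moreover have "(\<Sum>l\<in>torus K. sigma N K k \<eta> l) = (\<Sum>x\<in>occ N \<eta>. \<eta> (rep N (x + 1)))"
    using sum.reindex_bij_betw[OF bij_betw_pos_shift[OF G assms(3), of k],
        of "\<lambda>x. \<eta> (rep N (x + 1))"]
    by (simp add: sigma_eq[OF assms] cong: sum.cong)
  moreover have "\<dots> = 2 * K - N" using Erg_iff[OF G] assms by simp
  ultimately show ?thesis by (auto simp: Gamma_def sigma_def)
qed

section \<open>Injectivity and surjectivity\<close>

lemma Phi_inj:
  assumes "\<eta> \<in> Erg N K" "\<zeta> \<in> Erg N K" "N \<ge> 2" "K > 0" "k \<in> torus K" "m \<in> torus K"
    and pos: "pos N \<eta> k = pos N \<zeta> m" and sig: "sigma N K k \<eta> = sigma N K m \<zeta>"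
  shows "k = m \<and> \<eta> = \<zeta>"
proof -
  have G: "\<eta> \<in> Gamma N K" "\<zeta> \<in> Gamma N K" using assms by (auto simp: Erg_def)
  \<comment> \<open>Equal starting sites and equal steps give equal sites. The ranks
    \<open>k\<close> and \<open>m\<close> are not yet known to agree, so each side keeps its
    own.\<close>
  have eq: "j < K \<longrightarrow> pos N \<eta> (rep K (k + j)) = pos N \<zeta> (rep K (m + j))" if "j \<ge> 0" for j
    using that
  proof (induction j rule: int_ge_induct)
    case base
    show ?case using pos assms by (simp add: rep_id)
  next
    case (step j)
    show ?case
    proof
      assume "j + 1 < K"
      then have l: "j + 1 \<in> torus K" using step by (simp add: torus_def)
      show "pos N \<eta> (rep K (k + (j + 1))) = pos N \<zeta> (rep K (m + (j + 1)))"
        using step \<open>j + 1 < K\<close> sig pos_step_sigma[OF assms(1,3,4) l, of k]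
          pos_step_sigma[OF assms(2,3,4) l, of m] by (simp flip: add.assoc)
    qed
  qed
  have "pos N \<eta> (rep K (k + l - 1)) = pos N \<zeta> (rep K (m + l - 1))" if "l \<in> torus K" for l
    using eq[of "l - 1"] that by (simp add: torus_def add_diff_eq)
  then have "occ N \<eta> = occ N \<zeta>"
    using bij_betw_pos_shift[OF G(1) assms(4), of k] bij_betw_pos_shift[OF G(2) assms(4), of m]
    by (simp add: bij_betw_def cong: image_cong)
  then have "\<eta> = \<zeta>" by (rule Gamma_eqI[OF G])
  moreover have "k = m"
    using pos \<open>\<eta> = \<zeta>\<close> pos_occ(2)[OF G(1)] assms by metis
  ultimately show ?thesis by simp
qed

text \<open>The particles are placed along the walk from \<open>x\<close> with steps
  \<open>2 - s l\<close>. The rank \<open>k\<close> is not free: it is the rank of \<open>x\<close>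
  in the resulting configuration.\<close>

lemma Phi_surj:
  assumes x: "x \<in> torus N" and s: "s \<in> Gamma K (2 * K - N)" and N: "N \<ge> 2" and K: "K > 0"
  shows "\<exists>k\<in>torus K. \<exists>\<eta>\<in>Erg N K. pos N \<eta> k = x \<and> sigma N K k \<eta> = s"
proof -
  \<comment> \<open>The walk lifted to the integers, without reduction modulo \<open>N\<close>, so
    that its sites can be ordered.\<close>
  define Y where "Y j = x + (\<Sum>l\<in>{1..j}. 2 - s l)" for j
  define \<eta> where "\<eta> = (\<lambda>y\<in>torus N. if y \<in> (\<lambda>l. rep N (Y (l - 1))) ` torus K then 1 else 0 :: int)"
  note s01 = Gamma_01[OF s]
  have Y0: "Y 0 = x" by (simp add: Y_def)
  \<comment> \<open>The total displacement is \<open>2 * K - (2 * K - N)\<close>: the walk closes up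
    after exactly one turn.\<close>
  have YK: "Y K = x + N"
    using Gamma_sum[OF s] K by (simp add: Y_def sum_subtractf torus_def)
  have Ystep: "Y l = Y (l - 1) + 2 - s l" if "l \<in> torus K" for l
  proof -
    have "{1..l} = insert l {1..l - 1}" using that by (auto simp: torus_def)
    then show ?thesis by (simp add: Y_def)
  qed
  have Yless: "Y i < Y j" if "0 \<le> i" "i < j" "j \<le> K" for i j
    unfolding Y_def
  proof (intro add_strict_left_mono sum_strict_mono2)
    show "0 < 2 - s j" using that s01[of j] by (auto simp: torus_def)
    show "0 \<le> 2 - s l" if "l \<in> {1..j}" for l
      using that \<open>j \<le> K\<close> s01[of l] by (auto simp: torus_def)
  qed (use that in auto)
  have Yle: "Y i \<le> Y j" if "0 \<le> i" "i \<le> j" "j \<le> K" for i j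
    using Yless[of i j] that by (cases "i = j") auto
  have Yrange: "Y (l - 1) \<in> {x..<x + N}" if "l \<in> torus K" for l
    using Yle[of 0 "l - 1"] Yless[of "l - 1" K] that Y0 YK by (auto simp: torus_def)
  have Yinj: "inj_on (\<lambda>l. rep N (Y (l - 1))) (torus K)"
  proof (rule inj_onI)
    fix a b assume ab: "a \<in> torus K" "b \<in> torus K" "rep N (Y (a - 1)) = rep N (Y (b - 1))"
    then have "Y (a - 1) = Y (b - 1)"
      using inj_onD[OF inj_on_rep] Yrange by metis
    then show "a = b"
      using Yless[of "a - 1" "b - 1"] Yless[of "b - 1" "a - 1"] ab by (force simp: torus_def)
  qed
  have occ: "occ N \<eta> = (\<lambda>l. rep N (Y (l - 1))) ` torus K"
    using rep_in_torus[of N] N by (auto simp: occ_def \<eta>_def)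
  have eta01: "\<eta> y = 0 \<or> \<eta> y = 1" if "y \<in> torus N" for y using that by (simp add: \<eta>_def)
  have G: "\<eta> \<in> Gamma N K"
  proof -
    have "(\<Sum>y\<in>torus N. \<eta> y) = int (card (occ N \<eta>))"
      using sum_occ[of N \<eta> "\<lambda>_. 1"] eta01 by simp
    also have "\<dots> = K"
      using card_image[OF Yinj] K by (simp add: occ torus_def)
    finally show ?thesis by (auto simp: Gamma_def \<eta>_def)
  qed
  \<comment> \<open>If \<open>s l = 1\<close> the walk moves to the adjacent site; if
    \<open>s l = 0\<close> it jumps over that site, and monotonicity keeps all other lifts away from
    it.\<close>
  have next_site: "\<eta> (rep N (Y (l - 1) + 1)) = s l" if l: "l \<in> torus K" for l
  proof (cases "s l = 1")
    case True
    then have Yl: "Y l = Y (l - 1) + 1" using Ystep[OF l] by simp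
    have "rep N (Y l) \<in> occ N \<eta>"
    proof (cases "l = K")
      case True
      \<comment> \<open>The last step returns to the start, which carries the index 1.\<close>
      then have "rep N (Y l) = rep N (Y (1 - 1))" by (simp add: YK Y0 rep_eq_iff)
      then show ?thesis unfolding occ using K by (intro image_eqI[of _ _ 1]) (auto simp: torus_def)
    next
      case False
      then show ?thesis unfolding occ using l
        by (intro image_eqI[of _ _ "l + 1"]) (auto simp: torus_def)
    qed
    with Yl True show ?thesis by (simp add: occ_def)
  next
    case False
    then have s0: "s l = 0" using s01[OF l] by auto
    then have Yl: "Y l = Y (l - 1) + 2" using Ystep[OF l] by simp
    have "rep N (Y (l - 1) + 1) \<notin> occ N \<eta>"
    proof
      assume "rep N (Y (l - 1) + 1) \<in> occ N \<eta>"
      then obtain i where i: "i \<in> torus K" "rep N (Y (l - 1) + 1) = rep N (Y (i - 1))"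
        by (auto simp: occ)
      \<comment> \<open>This keeps the skipped site \<open>Y l - 1\<close> inside the window where
        \<open>rep N\<close> is injective.\<close>
      have "Y l \<le> x + N" using Yle[of l K] l YK by (simp add: torus_def)
      then have "Y (l - 1) + 1 \<in> {x..<x + N}" using Yrange[OF l] Yl by simp
      then have eq: "Y (l - 1) + 1 = Y (i - 1)"
        using inj_onD[OF inj_on_rep] i Yrange by metis
      show False
      proof (cases "i \<le> l")
        case True
        then show False using Yle[of "i - 1" "l - 1"] eq l i by (simp add: torus_def)
      next
        case False
        then show False using Yle[of l "i - 1"] eq l i Yl by (simp add: torus_def)
      qed
    qed
    moreover have "rep N (Y (l - 1) + 1) \<in> torus N" using N by (simp add: rep_in_torus)
    ultimately show ?thesis using s0 eta01[of "rep N (Y (l - 1) + 1)"] by (auto simp: occ_def)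
  qed
  have "(\<Sum>y\<in>occ N \<eta>. \<eta> (rep N (y + 1))) = (\<Sum>l\<in>torus K. \<eta> (rep N (Y (l - 1) + 1)))"
    unfolding occ by (subst sum.reindex[OF Yinj]) (simp add: rep_add_left)
  also have "\<dots> = 2 * K - N" using Gamma_sum[OF s] by (simp add: next_site)
  finally have E: "\<eta> \<in> Erg N K" using Erg_iff[OF G] N by simp
  have xo: "x \<in> occ N \<eta>"
    unfolding occ using x K Y0 by (intro image_eqI[of _ _ 1]) (auto simp: torus_def rep_id)
  define k where "k = count \<eta> x"
  have k: "k \<in> torus K" "pos N \<eta> k = x"
    using count_in_torus[OF G xo] pos_count[OF G xo] by (auto simp: k_def)
  \<comment> \<open>The construction gave only a set of sites; \<open>pos_step\<close> shows that
    the ranks from \<open>k\<close> on visit them in the order of the walk.\<close>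
  have follow: "j < K \<longrightarrow> pos N \<eta> (rep K (k + j)) = rep N (Y j)" if "j \<ge> 0" for j
    using that
  proof (induction j rule: int_ge_induct)
    case base
    show ?case using k x Y0 by (simp add: rep_id)
  next
    case (step j)
    show ?case
    proof
      assume "j + 1 < K"
      then have l: "j + 1 \<in> torus K" and IH: "pos N \<eta> (rep K (k + j)) = rep N (Y j)"
        using step by (auto simp: torus_def)
      have "pos N \<eta> (rep K (k + j + 1)) = rep N (rep N (Y j) + 2 - \<eta> (rep N (Y j + 1)))"
        using pos_step[OF E _ K, of "k + j"] N IH by (simp add: rep_add_left)
      also have "\<dots> = rep N (Y j + 2 - s (j + 1))"
        using next_site[OF l] rep_add_left[of N "Y j" "2 - s (j + 1)"] by (simp add: add_diff_eq)
      finally show "pos N \<eta> (rep K (k + (j + 1))) = rep N (Y (j + 1))"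
        using Ystep[OF l] by (simp add: add.assoc)
    qed
  qed
  have "sigma N K k \<eta> = s"
  proof (rule PiE_ext)
    show "sigma N K k \<eta> \<in> torus K \<rightarrow>\<^sub>E {0, 1}"
      using sigma_in_Gamma[OF E N K] by (simp add: Gamma_def)
    show "s \<in> torus K \<rightarrow>\<^sub>E {0, 1}" using s by (simp add: Gamma_def)
    show "sigma N K k \<eta> l = s l" if l: "l \<in> torus K" for l
      using sigma_eq[OF E N K l, of k] follow[of "l - 1"] next_site[OF l] l
      by (simp add: torus_def add_diff_eq rep_add_left)
  qed
  with k E show ?thesis by blast
qed

theorem proposition4p1:
  fixes N K :: int
  assumes "real_of_int N / 2 < real_of_int K" and "K < N"
  shows "(\<forall>\<eta>\<in>Erg N K. \<forall>k\<in>torus K. sigma N K k \<eta> \<in> Gamma K (2 * K - N)) \<and>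
    bij_betw (Phi N K) (torus K \<times> Erg N K) (torus N \<times> Gamma K (2 * K - N))"
proof -
  have "N < 2 * K" using assms(1) by linarith
  then have K: "K > 0" and N: "N \<ge> 2" using assms(2) by auto
  have "inj_on (Phi N K) (torus K \<times> Erg N K)"
    using Phi_inj[OF _ _ N K] by (auto simp: inj_on_def Phi_def)
  moreover have "Phi N K ` (torus K \<times> Erg N K) = torus N \<times> Gamma K (2 * K - N)"
  proof
    have "pos N \<eta> k \<in> torus N" if "k \<in> torus K" "\<eta> \<in> Erg N K" for k \<eta>
      using that pos_occ(1)[of \<eta> N K k] by (auto simp: Erg_def occ_def)
    then show "Phi N K ` (torus K \<times> Erg N K) \<subseteq> torus N \<times> Gamma K (2 * K - N)"
      using sigma_in_Gamma[OF _ N K] by (auto simp: Phi_def)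
    show "torus N \<times> Gamma K (2 * K - N) \<subseteq> Phi N K ` (torus K \<times> Erg N K)"
    proof clarify
      fix x s assume "x \<in> torus N" "s \<in> Gamma K (2 * K - N)"
      then obtain k \<eta> where "k \<in> torus K" "\<eta> \<in> Erg N K" "pos N \<eta> k = x" "sigma N K k \<eta> = s"
        using Phi_surj[OF _ _ N K] by blast
      then show "(x, s) \<in> Phi N K ` (torus K \<times> Erg N K)"
        by (intro image_eqI[of _ _ "(k, \<eta>)"]) (auto simp: Phi_def)
    qed
  qed
  ultimately show ?thesis
    using sigma_in_Gamma[OF _ N K] by (simp add: bij_betw_def)
qed

end
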